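(* Let $G$ be a connected, triangle-free graph. Then $G$ is $2$-$\gamma_{\rm MB}'$-critical if and only if $G \in \mathcal{B}$ or $G = C_5$.
   Context: All graphs are finite and simple; equality of graphs and membership in a family are meant up to isomorphism. A set $D\subseteq V(G)$ is a dominating set of $G$ if every vertex of $V(G)-D$ has a neighbor in $D$. Maker-Breaker domination game (S-game): two players, Dominator and Staller, alternately select a vertex of $G$ that has not been selected before, with Staller moving first. Dominator's goal is that at some point the set of vertices he has selected is a dominating set of $G$; Staller's goal is to prevent this. The game ends when one of the players accomplishes the goal. If Dominator wins the S-game on $G$ under optimal play, then $\gamma_{\rm MB}'(G)$ is the number of moves Dominator makes when both players play optimally (Dominator wants to minimize the number of his moves, Staller wants to maximize it); equivalently, it is the least $k$ such that Dominator has a strategy guaranteeing that he has selected a dominating set after at most $k$ of his moves. If Staller wins, $\gamma_{\rm MB}'(G)=\infty$. A graph $G$ is $2$-$\gamma_{\rm MB}'$-critical if $\gamma_{\rm MB}'(G)=2$ and $\gamma_{\rm MB}'(G-e)>2$ for every $e\in E(G)$, where $G-e$ is obtained from $G$ by deleting the edge $e$ (and $\infty>2$). Family $\mathcal{B}$: a graph $G$ belongs to $\mathcal{B}$ if either $G=K_{2,m}$ with $m\ge 3$, or $G$ is a bipartite graph with a bipartition $V(G)=V_1\cup V_2$, where $|V_1|=m\ge 3$, $|V_2|=n\ge 3$, such that $V_1$ contains exactly two vertices of degree $n$, $V_2$ contains exactly two vertices of degree $m$, and all other vertices have degree $2$. $C_5$ is the cycle on $5$ vertices. *)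

theory Defs
  imports "Graph_Theory.Graph_Theory" "HOL-Library.Extended_Nat"
begin

text \<open>
  A finite simple graph is a \<^term>\<open>pair_graph\<close>: an undirected edge \<open>uv\<close> is the pair of
  arcs \<open>(u,v)\<close>, \<open>(v,u)\<close>. Since arcs are symmetric, the degree of a vertex is its out-degree.
\<close>

abbreviation degree :: "'a pair_pre_digraph \<Rightarrow> 'a \<Rightarrow> nat" where
  "degree G v \<equiv> out_degree (with_proj G) v"

definition delete_edge :: "'a pair_pre_digraph \<Rightarrow> 'a \<Rightarrow> 'a \<Rightarrow> 'a pair_pre_digraph" where
  "delete_edge G u v = G\<lparr>parcs := parcs G - {(u, v), (v, u)}\<rparr>"

definition triangle_free :: "'a pair_pre_digraph \<Rightarrow> bool" where
  "triangle_free G \<longleftrightarrow> \<not> (\<exists>u v w. (u, v) \<in> parcs G \<and> (v, w) \<in> parcs G \<and> (w, u) \<in> parcs G)"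

definition dominating_set :: "'a pair_pre_digraph \<Rightarrow> 'a set \<Rightarrow> bool" where
  "dominating_set G D \<longleftrightarrow>
     D \<subseteq> pverts G \<and> (\<forall>v \<in> pverts G - D. \<exists>d \<in> D. (v, d) \<in> parcs G)"


subsection \<open>The Maker-Breaker domination game with Staller moving first\<close>

text \<open>
  A strategy \<open>\<sigma>\<close> of Dominator maps the list of Staller's moves so far (oldest first, including
  the move to be answered) to Dominator's reply; Dominator's own earlier moves are determined by
  that list. \<open>sgame_pos G \<sigma> xs D\<close>: in some play in which Dominator follows \<open>\<sigma>\<close>,
  Staller is to move, has selected the vertices \<open>xs\<close>, and Dominator has selected the set \<open>D\<close>.
  Only Staller's moves are checked for legality here; the legality of the replies is part of
  \<open>wins_within\<close>.
\<close>

inductive sgame_pos :: "'a pair_pre_digraph \<Rightarrow> ('a list \<Rightarrow> 'a) \<Rightarrow> 'a list \<Rightarrow> 'a set \<Rightarrow> bool"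
  for G \<sigma> where
  start: "sgame_pos G \<sigma> [] {}"
| round: "\<lbrakk>sgame_pos G \<sigma> xs D; \<not> dominating_set G D; x \<in> pverts G - (set xs \<union> D)\<rbrakk>
    \<Longrightarrow> sgame_pos G \<sigma> (xs @ [x]) (insert (\<sigma> (xs @ [x])) D)"

text \<open>
  Following \<open>\<sigma>\<close>, Dominator has selected a dominating set after at most \<open>k\<close> of his moves:
  whenever he has not yet done so, he has made fewer than \<open>k\<close> moves, the vertices are not
  exhausted, and \<open>\<sigma>\<close> answers every legal move of Staller by a vertex not selected before.
\<close>

definition wins_within :: "'a pair_pre_digraph \<Rightarrow> ('a list \<Rightarrow> 'a) \<Rightarrow> nat \<Rightarrow> bool" where
  "wins_within G \<sigma> k \<longleftrightarrow>
     (\<forall>xs D. sgame_pos G \<sigma> xs D \<and> \<not> dominating_set G D \<longrightarrow>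
        length xs < k \<and>
        pverts G - (set xs \<union> D) \<noteq> {} \<and>
        (\<forall>x \<in> pverts G - (set xs \<union> D).
           \<sigma> (xs @ [x]) \<in> pverts G - (set xs \<union> D \<union> {x})))"

text \<open>The infimum of the empty set is \<open>\<infinity>\<close>, the value when Staller wins.\<close>

definition mb_dom_number' :: "'a pair_pre_digraph \<Rightarrow> enat" (\<open>\<gamma>\<^sub>M\<^sub>B''\<close>) where
  "\<gamma>\<^sub>M\<^sub>B' G = Inf {enat k | k. \<exists>\<sigma>. wins_within G \<sigma> k}"

definition two_mb_critical :: "'a pair_pre_digraph \<Rightarrow> bool" where
  "two_mb_critical G \<longleftrightarrow>
     \<gamma>\<^sub>M\<^sub>B' G = 2 \<and> (\<forall>(u, v) \<in> parcs G. \<gamma>\<^sub>M\<^sub>B' (delete_edge G u v) > 2)"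


subsection \<open>The graphs in the characterization\<close>

definition bipartition :: "'a pair_pre_digraph \<Rightarrow> 'a set \<Rightarrow> 'a set \<Rightarrow> bool" where
  "bipartition G V1 V2 \<longleftrightarrow>
     pverts G = V1 \<union> V2 \<and> V1 \<inter> V2 = {} \<and> parcs G \<subseteq> V1 \<times> V2 \<union> V2 \<times> V1"

definition family_B :: "'a pair_pre_digraph \<Rightarrow> bool" where
  "family_B G \<longleftrightarrow>
     (\<exists>m \<ge> 3. K\<^bsub>2,m\<^esub> (with_proj G)) \<or>
     (\<exists>V1 V2 m n. bipartition G V1 V2 \<and> card V1 = m \<and> card V2 = n \<and> m \<ge> 3 \<and> n \<ge> 3 \<and>
        card {v \<in> V1. degree G v = n} = 2 \<and> card {v \<in> V2. degree G v = m} = 2 \<and>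
        (\<forall>v \<in> V1. degree G v \<noteq> n \<longrightarrow> degree G v = 2) \<and>
        (\<forall>v \<in> V2. degree G v \<noteq> m \<longrightarrow> degree G v = 2))"

text \<open>The cycle on the vertices \<open>0, \<dots>, n - 1\<close>, for \<open>n \<ge> 3\<close>.\<close>

definition cycle_graph :: "nat \<Rightarrow> nat pair_pre_digraph" where
  "cycle_graph n =
     \<lparr>pverts = {..<n},
      parcs = {(i, j). i < n \<and> j < n \<and> (j = Suc i mod n \<or> i = Suc j mod n)}\<rparr>"

end

theory Submission
  imports Defs
begin

text \<open>
  On at least four vertices, Dominator wins within two moves iff for every vertex \<open>x\<close> there is a
  cherry avoiding \<open>x\<close>: a vertex \<open>y\<close> and two further vertices each forming a
  dominating pair with \<open>y\<close>. Since edge deletion only shrinks the set of dominating pairs, a critical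
  graph equals each of its spanning subgraphs with this property. In a triangle-free graph the
  cherries at one centre \<open>y\<close> and those avoiding \<open>y\<close> force such a spanning subgraph of a
  very special shape: a graph from \<open>\<B>\<close> or a 4-cycle, a 5-cycle, or a perfect matching of four
  vertices (which the 4-cycle contains and which connectedness excludes). Conversely, deleting an
  edge from a graph in \<open>\<B>\<close> or from \<open>C\<^sub>5\<close> leaves no room for another such spanning
  subgraph, because on \<open>n\<close> vertices all graphs in \<open>\<B>\<close> have \<open>2n - 4\<close> edges
  and \<open>C\<^sub>5\<close> is neither bipartite nor large enough.
\<close>

section \<open>The game with two Dominator moves\<close>

lemma wins_within_mono: "wins_within G \<sigma> k \<Longrightarrow> k \<le> l \<Longrightarrow> wins_within G \<sigma> l"
  unfolding wins_within_def by fastforce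

lemma wins_withinD:
  assumes "wins_within G \<sigma> k" "sgame_pos G \<sigma> xs D" "\<not> dominating_set G D"
  shows "length xs < k"
    and "pverts G - (set xs \<union> D) \<noteq> {}"
    and "x \<in> pverts G - (set xs \<union> D) \<Longrightarrow> \<sigma> (xs @ [x]) \<in> pverts G - (set xs \<union> D \<union> {x})"
  using assms unfolding wins_within_def by blast+

text \<open>A nonempty set of \<open>enat\<close> values contains its infimum, and the empty set has
  infimum \<open>\<infinity>\<close>; so a finite value is attained by some strategy, and
  \<open>wins_within_mono\<close> relaxes its bound to \<open>k\<close>.\<close>

lemma mb_dom_number'_le_iff: "\<gamma>\<^sub>M\<^sub>B' G \<le> enat k \<longleftrightarrow> (\<exists>\<sigma>. wins_within G \<sigma> k)"
proof
  let ?S = "{enat k | k. \<exists>\<sigma>. wins_within G \<sigma> k}"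
  assume le: "\<gamma>\<^sub>M\<^sub>B' G \<le> enat k"
  then have "?S \<noteq> {}"
    unfolding mb_dom_number'_def by (auto simp: Inf_enat_def simp del: Collect_empty_eq)
  then have "Inf ?S \<in> ?S"
    unfolding Inf_enat_def by (metis (mono_tags, lifting) LeastI ex_in_conv)
  then obtain l \<sigma> where "Inf ?S = enat l" "wins_within G \<sigma> l"
    by blast
  with le show "\<exists>\<sigma>. wins_within G \<sigma> k"
    unfolding mb_dom_number'_def using wins_within_mono by fastforce
next
  assume "\<exists>\<sigma>. wins_within G \<sigma> k"
  then show "\<gamma>\<^sub>M\<^sub>B' G \<le> enat k"
    unfolding mb_dom_number'_def by (intro Inf_lower) blast
qed

section \<open>Positions of the first two rounds, and dominating pairs\<close>

lemma sgame_pos_Nil: "sgame_pos G \<sigma> [] D \<longleftrightarrow> D = {}"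
  by (auto elim: sgame_pos.cases intro: sgame_pos.start)

lemma sgame_pos_snoc:
  "sgame_pos G \<sigma> (xs @ [x]) D' \<longleftrightarrow>
    (\<exists>D. D' = insert (\<sigma> (xs @ [x])) D \<and> sgame_pos G \<sigma> xs D \<and> \<not> dominating_set G D \<and>
      x \<in> pverts G - (set xs \<union> D))"
  by (subst sgame_pos.simps) auto

lemma sgame_pos_1:
  "sgame_pos G \<sigma> [x] D \<longleftrightarrow> D = {\<sigma> [x]} \<and> \<not> dominating_set G {} \<and> x \<in> pverts G"
  using sgame_pos_snoc[of G \<sigma> "[]"] by (auto simp: sgame_pos_Nil)

lemma sgame_pos_2:
  "sgame_pos G \<sigma> [x, z] D \<longleftrightarrow> D = {\<sigma> [x], \<sigma> [x, z]} \<and>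
    \<not> dominating_set G {} \<and> \<not> dominating_set G {\<sigma> [x]} \<and>
    x \<in> pverts G \<and> z \<in> pverts G - {x, \<sigma> [x]}"
  using sgame_pos_snoc[of G \<sigma> "[x]"] by (auto simp: sgame_pos_1)

lemma dominating_set_empty: "pverts G \<noteq> {} \<Longrightarrow> \<not> dominating_set G {}"
  by (auto simp: dominating_set_def)

lemma dominating_set_pair:
  "dominating_set G {p, q} \<longleftrightarrow> p \<in> pverts G \<and> q \<in> pverts G \<and>
    (\<forall>v \<in> pverts G. v = p \<or> v = q \<or> (v, p) \<in> parcs G \<or> (v, q) \<in> parcs G)"
  by (auto simp: dominating_set_def)

lemma dominating_set_mono:
  "dominating_set G D \<Longrightarrow> D \<subseteq> D' \<Longrightarrow> D' \<subseteq> pverts G \<Longrightarrow> dominating_set G D'"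
  unfolding dominating_set_def by blast

text \<open>
  Dominator can afford two moves when he answers \<open>x\<close> by a vertex \<open>y\<close> that two different
  vertices complete to a dominating pair: Staller can take only one of them.
\<close>

definition cherry_cond :: "'a pair_pre_digraph \<Rightarrow> bool" where
  "cherry_cond G \<longleftrightarrow> (\<forall>x \<in> pverts G. \<exists>y w w'. distinct [x, y, w, w'] \<and>
     dominating_set G {y, w} \<and> dominating_set G {y, w'})"

lemma cherry_condE:
  assumes "cherry_cond G" "x \<in> pverts G"
  obtains y w w' where "distinct [x, y, w, w']" "dominating_set G {y, w}" "dominating_set G {y, w'}"
  using assms unfolding cherry_cond_def by blast

lemma cherry_cond_mono:
  assumes "cherry_cond G" "pverts H = pverts G" "parcs G \<subseteq> parcs H"
  shows "cherry_cond H"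
proof -
  have "dominating_set H {p, q}" if "dominating_set G {p, q}" for p q
    using that assms(2,3) unfolding dominating_set_pair by blast
  then show ?thesis
    using assms(1,2) unfolding cherry_cond_def by metis
qed

text \<open>The centre \<open>y\<close> is the reply to \<open>x\<close>. The leaves come from
  playing the second round twice: Staller takes some vertex \<open>z\<close> in one play and, in
  another, the vertex \<open>w\<close> with which Dominator answered \<open>z\<close>.\<close>

lemma wins_within_2_imp_cherry_cond:
  assumes wins: "wins_within G \<sigma> 2" and card: "card (pverts G) \<ge> 4"
  shows "cherry_cond G"
  unfolding cherry_cond_def
proof
  fix x assume x: "x \<in> pverts G"
  then have nd: "\<not> dominating_set G {}"
    by (intro dominating_set_empty) auto
  define y where "y = \<sigma> [x]"
  have y: "y \<in> pverts G - {x}"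
    using wins_withinD(3)[OF wins sgame_pos.start nd, of x] x by (simp add: y_def)
  show "\<exists>y w w'. distinct [x, y, w, w'] \<and> dominating_set G {y, w} \<and> dominating_set G {y, w'}"
  proof (cases "dominating_set G {y}")
    \<comment> \<open>The game ends here, so \<open>\<sigma>\<close> says nothing about further
      replies; any two of the remaining vertices serve, and \<open>card\<close> provides
      them.\<close>
    case True
    have "card (pverts G - {x, y}) \<ge> 2"
      using card x y by (auto simp: card_Diff_subset card_insert_if)
    then obtain w w' where w: "w \<in> pverts G - {x, y}" "w' \<in> pverts G - {x, y}" "w \<noteq> w'"
      by (auto simp: card_le_Suc_iff numeral_2_eq_2)
    then have "dominating_set G {y, w}" "dominating_set G {y, w'}"
      using True y by (auto intro: dominating_set_mono)
    with w y show ?thesis by (intro exI[of _ y] exI[of _ w] exI[of _ w']) auto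
  next
    case False
    have reply: "\<sigma> [x, z] \<in> pverts G - {x, y, z} \<and> dominating_set G {y, \<sigma> [x, z]}"
      if z: "z \<in> pverts G - {x, y}" for z
    proof
      have pos: "sgame_pos G \<sigma> [x] {y}"
        using x nd by (simp add: sgame_pos_1 y_def)
      show "\<sigma> [x, z] \<in> pverts G - {x, y, z}"
        using wins_withinD(3)[OF wins pos False, of z] z by simp
      have "sgame_pos G \<sigma> [x, z] {y, \<sigma> [x, z]}"
        using x z nd False by (simp add: sgame_pos_2 y_def)
      \<comment> \<open>Two Staller moves violate the bound \<open>length xs < 2\<close> of
        undominated positions.\<close>
      with wins_withinD(1)[OF wins] show "dominating_set G {y, \<sigma> [x, z]}"
        by fastforce
    qed
    have "pverts G - {x, y} \<noteq> {}"
      using wins_withinD(2)[OF wins, of "[x]" "{y}"] x nd False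
      by (simp add: sgame_pos_1 y_def insert_commute)
    then obtain z where z: "z \<in> pverts G - {x, y}" by blast
    define w where "w = \<sigma> [x, z]"
    define w' where "w' = \<sigma> [x, w]"
    have w: "w \<in> pverts G - {x, y, z}" "dominating_set G {y, w}"
      using reply[OF z] by (auto simp: w_def)
    then have "w' \<in> pverts G - {x, y, w}" "dominating_set G {y, w'}"
      using reply[of w] by (auto simp: w'_def)
    with w y show ?thesis by (intro exI[of _ y] exI[of _ w] exI[of _ w']) auto
  qed
qed

lemma cherry_cond_imp_wins_within_2:
  assumes cherry: "cherry_cond G"
  shows "\<exists>\<sigma>. wins_within G \<sigma> 2"
proof -
  obtain y w w' where cherry': "\<And>x. x \<in> pverts G \<Longrightarrow> distinct [x, y x, w x, w' x]"
    "\<And>x. x \<in> pverts G \<Longrightarrow> dominating_set G {y x, w x}"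
    "\<And>x. x \<in> pverts G \<Longrightarrow> dominating_set G {y x, w' x}"
    using cherry unfolding cherry_cond_def by metis
  \<comment> \<open>Staller's first move \<open>hd xs\<close> selects the cherry; the second,
    \<open>xs ! 1\<close>, decides between its leaves. Only lists of length one and two occur in
    plays that are still open.\<close>
  define \<sigma> where "\<sigma> xs = (if length xs = 1 then y (hd xs)
      else if xs ! 1 = w (hd xs) then w' (hd xs) else w (hd xs))" for xs
  have in_verts: "y x \<in> pverts G" "w x \<in> pverts G" "w' x \<in> pverts G" if "x \<in> pverts G" for x
    using cherry'[OF that] by (auto simp: dominating_set_pair)
  have "wins_within G \<sigma> 2"
    unfolding wins_within_def
  proof (intro allI impI)
    fix xs D assume *: "sgame_pos G \<sigma> xs D \<and> \<not> dominating_set G D"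
    then have D: "sgame_pos G \<sigma> xs D" "\<not> dominating_set G D" by auto
    have two: "dominating_set G D'" if pos: "sgame_pos G \<sigma> [x, z] D'" for x z D'
    proof -
      from pos have x: "x \<in> pverts G" and D': "D' = {\<sigma> [x], \<sigma> [x, z]}"
        by (auto simp: sgame_pos_2)
      show ?thesis using cherry'[OF x] by (auto simp: \<sigma>_def D')
    qed
    have short: "length xs < 2"
    proof (rule ccontr)
      assume "\<not> length xs < 2"
      then obtain x z xs' where xs: "xs = x # z # xs'"
        by (cases xs rule: remdups_adj.cases) auto
      \<comment> \<open>A third round is played only from an undominated position, so the position
        after two rounds is either the whole play or undominated. Both are excluded by
        \<open>two\<close>.\<close>
      have "\<exists>D'. sgame_pos G \<sigma> [x, z] D' \<and> (xs' = [] \<or> \<not> dominating_set G D')"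
        using D(1) unfolding xs
      proof (induction xs' arbitrary: D rule: rev_induct)
        case (snoc a as)
        then have "\<exists>D. sgame_pos G \<sigma> (x # z # as) D \<and> \<not> dominating_set G D"
          using sgame_pos_snoc[of G \<sigma> "x # z # as" a D] by auto
        with snoc.IH show ?case by blast
      qed auto
      with two D xs show False by auto
    qed
    show "length xs < 2 \<and> pverts G - (set xs \<union> D) \<noteq> {} \<and>
        (\<forall>x \<in> pverts G - (set xs \<union> D). \<sigma> (xs @ [x]) \<in> pverts G - (set xs \<union> D \<union> {x}))"
    proof (cases xs)
      case Nil
      with D have [simp]: "D = {}" by (simp add: sgame_pos_Nil)
      from D have "pverts G \<noteq> {}" by (auto simp: dominating_set_def)
      moreover have "y x \<noteq> x" if "x \<in> pverts G" for x
        using cherry'(1)[OF that] by auto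
      ultimately show ?thesis using in_verts by (auto simp: Nil \<sigma>_def)
    next
      case (Cons x xs')
      with short have xs: "xs = [x]" by simp
      with D have x: "x \<in> pverts G" and D': "D = {y x}" by (auto simp: sgame_pos_1 \<sigma>_def)
      show ?thesis
        using cherry'(1)[OF x] in_verts[OF x] by (auto simp: xs D' \<sigma>_def)
    qed
  qed
  then show ?thesis by blast
qed

section \<open>Small values of the game number and the order of the graph\<close>

lemma mb_dom_number'_le_2_iff:
  assumes "card (pverts G) \<ge> 4"
  shows "\<gamma>\<^sub>M\<^sub>B' G \<le> 2 \<longleftrightarrow> cherry_cond G"
  using mb_dom_number'_le_iff[of G 2] wins_within_2_imp_cherry_cond[OF _ assms]
    cherry_cond_imp_wins_within_2[of G]
  by (auto simp: numeral_eq_enat)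

text \<open>Since the value exceeds 1, some play is undominated after one round; its first two
  rounds occupy four different vertices.\<close>

lemma mb_dom_number'_2_imp_card:
  assumes fin: "finite (pverts G)" and two: "\<gamma>\<^sub>M\<^sub>B' G = 2"
  shows "card (pverts G) \<ge> 4"
proof -
  from two obtain \<sigma> where wins: "wins_within G \<sigma> 2"
    using mb_dom_number'_le_iff[of G 2] by (auto simp: numeral_eq_enat)
  have "\<not> wins_within G \<sigma> 1"
    using two mb_dom_number'_le_iff[of G 1] by (auto simp: numeral_eq_enat)
  \<comment> \<open>The legality clauses of \<open>wins_within\<close> are common to both bounds, so
    only the length bound can fail for \<open>1\<close>.\<close>
  then obtain xs D where pos: "sgame_pos G \<sigma> xs D" and nd: "\<not> dominating_set G D"
    and not_1: "\<not> length xs < 1"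
    using wins unfolding wins_within_def by blast
  from wins pos nd have "length xs < 2" unfolding wins_within_def by blast
  with not_1 obtain x where xs: "xs = [x]" by (cases xs) auto
  with pos have D: "D = {\<sigma> [x]}" and x: "x \<in> pverts G" and nd0: "\<not> dominating_set G {}"
    by (auto simp: sgame_pos_1)
  have y: "\<sigma> [x] \<in> pverts G - {x}"
    using wins_withinD(3)[OF wins sgame_pos.start nd0, of x] x by simp
  obtain z where z: "z \<in> pverts G - {x, \<sigma> [x]}"
    using wins_withinD(2)[OF wins pos nd] by (auto simp: xs D)
  have "\<sigma> ([x] @ [z]) \<in> pverts G - (set [x] \<union> {\<sigma> [x]} \<union> {z})"
    using wins_withinD(3)[OF wins pos nd, of z] z by (simp add: xs D)
  with x y z have "{x, \<sigma> [x], z, \<sigma> [x, z]} \<subseteq> pverts G" "card {x, \<sigma> [x], z, \<sigma> [x, z]} = 4"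
    by auto
  then show ?thesis using fin card_mono by metis
qed

text \<open>A win in one move makes every first reply a universal vertex. The reply \<open>u\<close>
  to some \<open>x\<close> and the reply \<open>v\<close> to \<open>u\<close> are two such vertices,
  and any third vertex completes a triangle.\<close>

lemma triangle_free_mb_dom_number'_gt_1:
  assumes tf: "triangle_free G" and sym: "sym (parcs G)" and card: "card (pverts G) \<ge> 3"
  shows "\<not> \<gamma>\<^sub>M\<^sub>B' G \<le> 1"
proof
  assume "\<gamma>\<^sub>M\<^sub>B' G \<le> 1"
  then obtain \<sigma> where wins: "wins_within G \<sigma> 1"
    using mb_dom_number'_le_iff[of G 1] by (auto simp: one_enat_def)
  have nd: "\<not> dominating_set G {}"
    using card by (intro dominating_set_empty) auto
  have reply: "\<sigma> [x] \<in> pverts G - {x} \<and> dominating_set G {\<sigma> [x]}" if x: "x \<in> pverts G" for x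
  proof
    show "\<sigma> [x] \<in> pverts G - {x}"
      using wins_withinD(3)[OF wins sgame_pos.start nd, of x] x by simp
    show "dominating_set G {\<sigma> [x]}"
      using wins_withinD(1)[OF wins, of "[x]" "{\<sigma> [x]}"] x nd by (auto simp: sgame_pos_1)
  qed
  obtain x where x: "x \<in> pverts G" using card by fastforce
  define u v where "u = \<sigma> [x]" and "v = \<sigma> [u]"
  have u: "u \<in> pverts G" "dominating_set G {u}" using reply[OF x] by (auto simp: u_def)
  have v: "v \<in> pverts G" "v \<noteq> u" "dominating_set G {v}"
    using reply[OF u(1)] by (auto simp: v_def)
  have "\<not> pverts G \<subseteq> {u, v}"
    using card card_mono[of "{u, v}" "pverts G"] v(2) by auto
  then obtain z where z: "z \<in> pverts G" "z \<noteq> u" "z \<noteq> v" by blast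
  have "(z, u) \<in> parcs G" "(z, v) \<in> parcs G" "(u, v) \<in> parcs G"
    using u v z by (auto simp: dominating_set_def)
  then show False using tf sym unfolding triangle_free_def by (meson symD)
qed


section \<open>Spanning subgraphs of triangle-free graphs\<close>

text \<open>
  On at least five vertices these are the members of \<^const>\<open>family_B\<close>: \<open>A = V1\<close> or
  \<open>B = V2\<close> gives \<open>K\<^bsub>2,m\<^esub>\<close>. On four vertices it is the 4-cycle.
\<close>

definition spanning_core :: "'a set \<Rightarrow> 'a rel \<Rightarrow> bool" where
  "spanning_core V E \<longleftrightarrow> (\<exists>V1 V2 A B. V = V1 \<union> V2 \<and> V1 \<inter> V2 = {} \<and>
     A \<subseteq> V1 \<and> B \<subseteq> V2 \<and> card A = 2 \<and> card B = 2 \<and>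
     E = A \<times> V2 \<union> V1 \<times> B \<union> (V2 \<times> A \<union> B \<times> V1))"

definition spanning_pentagon :: "'a set \<Rightarrow> 'a rel \<Rightarrow> bool" where
  "spanning_pentagon V E \<longleftrightarrow> (\<exists>a b c d e. distinct [a, b, c, d, e] \<and> V = {a, b, c, d, e} \<and>
     E = {(a, b), (b, c), (c, d), (d, e), (e, a), (b, a), (c, b), (d, c), (e, d), (a, e)})"

definition spanning_matching :: "'a set \<Rightarrow> 'a rel \<Rightarrow> bool" where
  "spanning_matching V E \<longleftrightarrow> (\<exists>a b c d. distinct [a, b, c, d] \<and> V = {a, b, c, d} \<and>
     E = {(a, b), (c, d), (b, a), (d, c)})"

lemma spanning_coreI:
  assumes "V = V1 \<union> V2" "V1 \<inter> V2 = {}" "a \<in> V1" "a' \<in> V1" "a \<noteq> a'" "b \<in> V2" "b' \<in> V2" "b \<noteq> b'"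
    and "sym R" "{a, a'} \<times> V2 \<subseteq> R" "V1 \<times> {b, b'} \<subseteq> R"
  shows "\<exists>E \<subseteq> R. spanning_core V E"
proof -
  let ?E = "{a, a'} \<times> V2 \<union> V1 \<times> {b, b'} \<union> (V2 \<times> {a, a'} \<union> {b, b'} \<times> V1)"
  have "?E \<subseteq> R"
    using assms(9-11) by (auto intro: symD[OF assms(9)])
  moreover have "spanning_core V ?E"
    unfolding spanning_core_def
    by (rule exI[of _ V1], rule exI[of _ V2], rule exI[of _ "{a, a'}"], rule exI[of _ "{b, b'}"],
      intro conjI refl, use assms(1-8) in auto)
  ultimately show ?thesis by (intro exI[of _ ?E] conjI)
qed

lemma (in pair_graph) sym_parcs: "sym (parcs G)"
  using pair_sym_arcs by (simp add: symmetric_def)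

text \<open>The classification below is applied to a critical graph and also to a graph supposed to
  keep value at most 2 after an edge has been deleted; the latter may be disconnected.\<close>

locale triangle_free_cherry = pair_graph +
  assumes triangle_free: "triangle_free G"
    and cherry: "cherry_cond G"
    and card4: "card (pverts G) \<ge> 4"
begin

lemma adj_sym: "(u, v) \<in> parcs G \<Longrightarrow> (v, u) \<in> parcs G"
  using sym_parcs by (rule symD)

lemma adj_commute: "(u, v) \<in> parcs G \<longleftrightarrow> (v, u) \<in> parcs G"
  using adj_sym by blast

lemma no_triangle: "(u, v) \<in> parcs G \<Longrightarrow> (v, w) \<in> parcs G \<Longrightarrow> (u, w) \<notin> parcs G"
  using triangle_free adj_sym unfolding triangle_free_def by blast

lemma adj_neq: "(u, v) \<in> parcs G \<Longrightarrow> u \<noteq> v"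
  using no_triangle by blast

lemma dominated:
  "dominating_set G {p, q} \<Longrightarrow> v \<in> pverts G \<Longrightarrow>
    v = p \<or> v = q \<or> (v, p) \<in> parcs G \<or> (v, q) \<in> parcs G"
  by (auto simp: dominating_set_pair)

lemma not_subset_3: "\<not> pverts G \<subseteq> {a, b, c}"
proof
  assume "pverts G \<subseteq> {a, b, c}"
  then have "card (pverts G) \<le> card {a, b, c}" by (intro card_mono) auto
  with card4 show False using card_insert_le_m1[of 3 "{b, c}" a] card_insert_le_m1[of 2 "{c}" b]
    by simp
qed

text \<open>The parts are the neighbourhood \<open>V2\<close> of \<open>y\<close> and its complement
  \<open>V1\<close>. Vertices of \<open>V1\<close> other than \<open>y\<close> must be dominated by
  \<open>w\<close> and by \<open>w'\<close>, so these two are joined to all of \<open>V1\<close>,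
  which is therefore independent. What is missing is a second vertex joined to all of
  \<open>V2\<close>; it comes from a cherry avoiding \<open>y\<close>.\<close>

lemma core_if_adjacent_centre:
  assumes "y \<in> pverts G" "w \<noteq> w'" "dominating_set G {y, w}" "dominating_set G {y, w'}"
    and "(y, w) \<in> parcs G" "(y, w') \<in> parcs G"
  shows "\<exists>E \<subseteq> parcs G. spanning_core (pverts G) E"
proof -
  define V2 where "V2 = {v. (y, v) \<in> parcs G}"
  define V1 where "V1 = pverts G - V2"
  have V: "pverts G = V1 \<union> V2" "V1 \<inter> V2 = {}"
    by (auto simp: V1_def V2_def dest: in_arcsD2)
  have yV: "y \<in> V1" and wV: "w \<in> V2" "w' \<in> V2"
    using assms adj_neq by (auto simp: V1_def V2_def)
  have w_full: "(v, w) \<in> parcs G \<and> (v, w') \<in> parcs G" if "v \<in> V1" for v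
    using dominated[OF assms(3), of v] dominated[OF assms(4), of v] that assms(5,6)
    by (auto simp: adj_commute V1_def V2_def)
  have indep1: "(u, v) \<notin> parcs G" if "u \<in> V1" "v \<in> V1" for u v
    using w_full that no_triangle by blast
  have indep2: "(u, v) \<notin> parcs G" if "u \<in> V2" "v \<in> V2" for u v
    using that no_triangle by (auto simp: V2_def)
  obtain p q q' where pq: "distinct [y, p, q, q']" "dominating_set G {p, q}" "dominating_set G {p, q'}"
    using cherry assms(1) by (rule cherry_condE)
  have V2_pair: "u \<in> V2 \<or> v \<in> V2" if "dominating_set G {u, v}" "u \<noteq> y" "v \<noteq> y" for u v
    using dominated[OF that(1) assms(1)] that(2,3) by (auto simp: V2_def)
  have "\<exists>z \<in> V1. z \<noteq> y \<and> (\<forall>v \<in> V2. (z, v) \<in> parcs G)"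
  proof (cases "\<exists>r s. r \<in> V2 \<and> s \<in> V2 \<and> dominating_set G {r, s}")
    case True
    then obtain r s where rs: "r \<in> V2" "s \<in> V2" "dominating_set G {r, s}" by blast
    \<comment> \<open>A dominating pair inside the independent set \<open>V2\<close> exhausts it.
      Then \<open>V2\<close> consists of \<open>w\<close> and \<open>w'\<close>, and any vertex of
      \<open>V1\<close> other than \<open>y\<close> will do.\<close>
    have "V2 \<subseteq> {r, s}"
      using dominated[OF rs(3)] indep2 rs V by blast
    then have V2: "V2 = {w, w'}" using wV assms(2) by auto
    obtain z where "z \<in> pverts G" "z \<notin> {y, w, w'}" using not_subset_3 by blast
    with V2 V w_full adj_sym show ?thesis by (intro bexI[of _ z]) auto
  next
    case False
    have mem: "p \<in> V1 \<union> V2" "q \<in> V1 \<union> V2" "q' \<in> V1 \<union> V2"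
      using pq(2,3) V by (auto simp: dominating_set_pair)
    \<comment> \<open>To dominate \<open>y\<close>, each of the two pairs meets \<open>V2\<close>,
      now in exactly one vertex; so both leaves lie in the part opposite to the centre.\<close>
    consider "p \<in> V2" "q \<in> V1" "q' \<in> V1" | "p \<in> V1" "q \<in> V2" "q' \<in> V2"
      using V2_pair[OF pq(2)] V2_pair[OF pq(3)] pq(1) False pq mem by auto
    then show ?thesis
    proof cases
      case 1
      have "(q, v) \<in> parcs G" if v: "v \<in> V2" for v
      proof (cases "v = p")
        \<comment> \<open>The other leaf gives the arc to \<open>p\<close>: \<open>q'\<close> lies
          in the independent set \<open>V1\<close>, so only \<open>p\<close> can dominate
          \<open>q\<close>.\<close>
        case True
        then show ?thesis
          using dominated[OF pq(3), of q] indep1 1 pq(1) V by auto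
      next
        case False
        then show ?thesis
          using dominated[OF pq(2), of v] indep2 1 v pq(1) V by (auto simp: adj_commute)
      qed
      then show ?thesis using 1 pq(1) by (intro bexI[of _ q]) auto
    next
      case 2
      \<comment> \<open>The vertex \<open>v\<close> differs from \<open>q\<close> or from
        \<open>q'\<close>; in that pair only \<open>p\<close> can dominate it.\<close>
      have "(p, v) \<in> parcs G" if v: "v \<in> V2" for v
        using dominated[OF pq(2), of v] dominated[OF pq(3), of v] indep2 2 v pq(1) V by (auto simp: adj_commute)
      then show ?thesis using 2 pq(1) by (intro bexI[of _ p]) auto
    qed
  qed
  then obtain z where z: "z \<in> V1" "z \<noteq> y" "\<forall>v \<in> V2. (z, v) \<in> parcs G" by blast
  show ?thesis
    by (rule spanning_coreI[OF V yV z(1) z(2)[symmetric] wV assms(2) sym_parcs])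
      (use z w_full in \<open>auto simp: V2_def\<close>)
qed

text \<open>Here \<open>w\<close> and \<open>w'\<close> are adjacent, and a vertex other than
  \<open>y\<close> and \<open>w\<close> that is not a neighbour of \<open>y\<close> would form a
  triangle with them. So \<open>{y, w}\<close> and the neighbourhood \<open>V2\<close> of
  \<open>y\<close> make up the graph. A cherry avoiding \<open>y\<close> either shows
  \<open>w\<close> joined to all of \<open>V2\<close>, or contains a pair inside \<open>V2\<close>,
  which leaves only four vertices.\<close>

lemma core_or_matching_if_mixed_centre:
  assumes "y \<in> pverts G" "y \<noteq> w" "dominating_set G {y, w}" "dominating_set G {y, w'}"
    and "(y, w) \<notin> parcs G" "(y, w') \<in> parcs G"
  shows "\<exists>E \<subseteq> parcs G. spanning_core (pverts G) E \<or> spanning_matching (pverts G) E"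
proof -
  define V2 where "V2 = {v. (y, v) \<in> parcs G}"
  have w: "w \<in> pverts G" "w \<notin> V2" and w': "w' \<in> V2" and y: "y \<notin> V2"
    using assms adj_neq by (auto simp: dominating_set_pair V2_def)
  have ww': "(w, w') \<in> parcs G"
    using dominated[OF assms(4) w(1)] assms w by (auto simp: adj_commute)
  have V: "pverts G = {y, w} \<union> V2" "{y, w} \<inter> V2 = {}"
  proof
    show "pverts G \<subseteq> {y, w} \<union> V2"
    proof
      fix v assume v: "v \<in> pverts G"
      show "v \<in> {y, w} \<union> V2"
        using dominated[OF assms(3) v] dominated[OF assms(4) v] no_triangle[of v w w'] ww' w'
        by (auto simp: adj_commute V2_def)
    qed
    show "{y, w} \<union> V2 \<subseteq> pverts G"
      using assms(1) w by (auto simp: V2_def dest: in_arcsD2)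
  qed (use w y in auto)
  have indep2: "(u, v) \<notin> parcs G" if "u \<in> V2" "v \<in> V2" for u v
    using that no_triangle by (auto simp: V2_def)
  obtain b where b: "b \<in> V2" "b \<noteq> w'"
    using not_subset_3[of y w w'] V by blast
  obtain p q q' where pq: "distinct [y, p, q, q']" "dominating_set G {p, q}" "dominating_set G {p, q'}"
    using cherry assms(1) by (rule cherry_condE)
  show ?thesis
  proof (cases "\<exists>r s. r \<in> V2 \<and> s \<in> V2 \<and> dominating_set G {r, s}")
    case True
    then obtain r s where rs: "r \<in> V2" "s \<in> V2" "dominating_set G {r, s}" by blast
    have "V2 \<subseteq> {r, s}"
      using dominated[OF rs(3)] indep2 rs V by blast
    then have V2: "V2 = {b, w'}" using w' b by auto
    let ?E = "{(y, b), (w, w'), (b, y), (w', w)}"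
    have "spanning_matching (pverts G) ?E"
      unfolding spanning_matching_def
      by (rule exI[of _ y], rule exI[of _ b], rule exI[of _ w], rule exI[of _ w'],
        use V V2 w y w' b assms(2) in auto)
    moreover have "?E \<subseteq> parcs G"
      using b ww' by (auto simp: adj_commute V2_def)
    ultimately show ?thesis by (intro exI[of _ ?E] conjI disjI2)
  next
    case False
    have "p \<in> pverts G" "q \<in> pverts G" "q' \<in> pverts G"
      using pq(2,3) by (simp_all add: dominating_set_pair)
    then have mem: "p \<in> {w} \<union> V2" "q \<in> {w} \<union> V2" "q' \<in> {w} \<union> V2"
      using pq(1) V(1) by auto
    \<comment> \<open>With the centre in \<open>V2\<close>, both leaves would have to be
      \<open>w\<close>.\<close>
    have "p \<notin> V2"
    proof
      assume "p \<in> V2"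
      with False pq(2,3) have "q \<notin> V2" "q' \<notin> V2" by blast+
      with mem pq(1) show False by auto
    qed
    with mem pq(1) have p: "p = w" "q \<in> V2" "q' \<in> V2" by auto
    have "(w, v) \<in> parcs G" if v: "v \<in> V2" for v
    proof -
      have "v \<in> pverts G" "v \<noteq> w" "q \<noteq> q'" using V(1) v w(2) pq(1) by auto
      then show ?thesis
        using dominated[OF pq(2), of v] dominated[OF pq(3), of v] indep2[OF v p(2)] indep2[OF v p(3)]
          adj_commute[of w v] unfolding p(1) by blast
    qed
    then have "\<exists>E \<subseteq> parcs G. spanning_core (pverts G) E"
      using b w' adj_sym
      by (intro spanning_coreI[OF V, of y w b w']) (auto simp: assms(2) sym_parcs V2_def)
    then show ?thesis by blast
  qed
qed

text \<open>As \<open>w\<close> and \<open>w'\<close> are adjacent, the triangle argument leaves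
  only \<open>y\<close>, \<open>w\<close>, \<open>w'\<close> and the neighbourhood \<open>A\<close>
  of \<open>y\<close>, and no vertex of \<open>A\<close> sees both \<open>w\<close> and
  \<open>w'\<close>. A single vertex in \<open>A\<close> gives the matching, otherwise a dominating
  pair inside \<open>A\<close> gives the pentagon; the remaining case is contradictory.\<close>

lemma pentagon_or_matching_if_far_centre:
  assumes "y \<in> pverts G" "distinct [y, w, w']" "dominating_set G {y, w}" "dominating_set G {y, w'}"
    and "(y, w) \<notin> parcs G" "(y, w') \<notin> parcs G"
  shows "\<exists>E \<subseteq> parcs G. spanning_pentagon (pverts G) E \<or> spanning_matching (pverts G) E"
proof -
  define A where "A = {v. (y, v) \<in> parcs G}"
  have w: "w \<in> pverts G" "w \<notin> A" "w' \<in> pverts G" "w' \<notin> A" and y: "y \<notin> A"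
    using assms adj_neq by (auto simp: dominating_set_pair A_def)
  have ww': "(w, w') \<in> parcs G"
    using dominated[OF assms(4) w(1)] assms by (auto simp: adj_commute)
  have V: "pverts G = {y, w, w'} \<union> A"
  proof
    show "pverts G \<subseteq> {y, w, w'} \<union> A"
    proof
      fix v assume v: "v \<in> pverts G"
      show "v \<in> {y, w, w'} \<union> A"
        using dominated[OF assms(3) v] dominated[OF assms(4) v] no_triangle[of v w w'] ww'
        by (auto simp: adj_commute A_def)
    qed
    show "{y, w, w'} \<union> A \<subseteq> pverts G"
      using assms(1) w by (auto simp: A_def dest: in_arcsD2)
  qed
  have indep: "(u, v) \<notin> parcs G" if "u \<in> A" "v \<in> A" for u v
    using that no_triangle by (auto simp: A_def)
  have disj: "(w, v) \<notin> parcs G \<or> (w', v) \<notin> parcs G" for v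
    using ww' no_triangle adj_sym by blast
  obtain a where a: "a \<in> A"
    using not_subset_3[of y w w'] V by blast
  obtain p q q' where pq: "distinct [y, p, q, q']" "dominating_set G {p, q}" "dominating_set G {p, q'}"
    using cherry assms(1) by (rule cherry_condE)
  have A_pair: "u \<in> A \<or> v \<in> A" if "dominating_set G {u, v}" "u \<noteq> y" "v \<noteq> y" for u v
    using dominated[OF that(1) assms(1)] that(2,3) by (auto simp: A_def)
  show ?thesis
  proof (cases "A = {a}")
    case True
    let ?E = "{(y, a), (w, w'), (a, y), (w', w)}"
    have "spanning_matching (pverts G) ?E"
      unfolding spanning_matching_def
      by (rule exI[of _ y], rule exI[of _ a], rule exI[of _ w], rule exI[of _ w'],
        use V w y assms(2) True in auto)
    moreover have "?E \<subseteq> parcs G"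
      using a ww' by (auto simp: adj_commute A_def)
    ultimately show ?thesis by (intro exI[of _ ?E] conjI disjI2)
  next
    case A2: False
    have pentagon: ?thesis
      if c: "c \<in> A" "c' \<in> A" "c \<noteq> c'" "A = {c, c'}" "(w, c) \<in> parcs G" "(w', c') \<in> parcs G" for c c'
    proof -
      let ?E = "{(y, c), (c, w), (w, w'), (w', c'), (c', y), (c, y), (w, c), (w', w), (c', w'), (y, c')}"
      have "spanning_pentagon (pverts G) ?E"
        unfolding spanning_pentagon_def
        by (rule exI[of _ y], rule exI[of _ c], rule exI[of _ w], rule exI[of _ w'], rule exI[of _ c'],
          use V w y assms(2) c in auto)
      moreover have "?E \<subseteq> parcs G"
        using c ww' by (auto simp: adj_commute A_def)
      ultimately show ?thesis by (intro exI[of _ ?E] conjI disjI1)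
    qed
    show ?thesis
    proof (cases "\<exists>r s. r \<in> A \<and> s \<in> A \<and> dominating_set G {r, s}")
      case True
      then obtain r s where rs: "r \<in> A" "s \<in> A" "dominating_set G {r, s}" by blast
      have "A \<subseteq> {r, s}"
        using dominated[OF rs(3)] indep rs V by blast
      with rs A2 a have A: "A = {r, s}" "r \<noteq> s" by auto
      \<comment> \<open>Without a common neighbour, \<open>w\<close> and \<open>w'\<close> are
        dominated by different vertices of the pair; this closes the 5-cycle through
        \<open>y\<close>.\<close>
      have "(w, r) \<in> parcs G \<and> (w', s) \<in> parcs G \<or> (w, s) \<in> parcs G \<and> (w', r) \<in> parcs G"
        using dominated[OF rs(3) w(1)] dominated[OF rs(3) w(3)] w rs disj by blast
      then show ?thesis using pentagon[of r s] pentagon[of s r] A rs by blast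
    next
      case False
      have "p \<in> pverts G" "q \<in> pverts G" "q' \<in> pverts G"
        using pq(2,3) by (simp_all add: dominating_set_pair)
      then have mem: "p \<in> {w, w'} \<union> A" "q \<in> {w, w'} \<union> A" "q' \<in> {w, w'} \<union> A"
        using pq(1) V by auto
      \<comment> \<open>If the centre lay in \<open>A\<close>, the leaves would be \<open>w\<close>
        and \<open>w'\<close>, and a second vertex of \<open>A\<close> would be adjacent to
        both.\<close>
      have "p \<notin> A"
      proof
        assume p: "p \<in> A"
        with False pq mem have "{q, q'} = {w, w'}" by auto
        then have pw: "dominating_set G {p, w}" "dominating_set G {p, w'}"
          using pq by (auto simp: doubleton_eq_iff)
        have "v = p" if v: "v \<in> A" for v
        proof (rule ccontr)
          assume "v \<noteq> p"
          moreover have "v \<in> pverts G" "v \<noteq> w" "v \<noteq> w'" using v V w by auto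
          ultimately have "(v, w) \<in> parcs G" "(v, w') \<in> parcs G"
            using dominated[of p w v] dominated[of p w' v] indep[OF v p] pw by blast+
          then show False using disj adj_sym by blast
        qed
        with p A2 a show False by blast
      qed
      then have q: "q \<in> A" "q' \<in> A" "p \<in> {w, w'}"
        using A_pair[OF pq(2)] A_pair[OF pq(3)] pq(1) mem by auto
      have p_full: "(p, v) \<in> parcs G" if v: "v \<in> A" for v
        using dominated[OF pq(2), of v] dominated[OF pq(3), of v] indep v pq(1) V q \<open>p \<notin> A\<close>
        by (auto simp: adj_commute)
      \<comment> \<open>As \<open>p\<close> is joined to all of \<open>A\<close>, the other one of
        \<open>w\<close>, \<open>w'\<close> has \<open>p\<close> as its only neighbour.\<close>
      define u where "u = (if p = w then w' else w)"
      have u: "{w, w'} = {p, u}" "u \<noteq> p" using q assms(2) by (auto simp: u_def)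
      have uA: "(u, v) \<notin> parcs G" if "v \<in> A" for v
        using disj p_full[OF that] u by (auto simp: doubleton_eq_iff)
      have uV: "u \<in> pverts G" "u \<notin> A" "u \<noteq> y" and yu: "(u, y) \<notin> parcs G"
        using u w assms(2,5,6) by (auto simp: adj_commute u_def)
      \<comment> \<open>In a cherry avoiding \<open>p\<close>, both pairs must contain
        \<open>u\<close> in order to dominate it, which makes \<open>u\<close> the centre.\<close>
      obtain r s s' where rs: "distinct [p, r, s, s']" "dominating_set G {r, s}" "dominating_set G {r, s'}"
        by (rule cherry_condE[OF cherry \<open>p \<in> pverts G\<close>])
      have V': "pverts G = {y, p, u} \<union> A" using V u by auto
      have "r \<in> pverts G" "s \<in> pverts G" "s' \<in> pverts G"
        using rs(2,3) by (simp_all add: dominating_set_pair)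
      then have mem': "r \<in> {y, u} \<union> A" "s \<in> {y, u} \<union> A" "s' \<in> {y, u} \<union> A"
        using rs(1) V' by auto
      have "u = r \<or> u = s" "u = r \<or> u = s'"
        using dominated[OF rs(2) uV(1)] dominated[OF rs(3) uV(1)] mem' uA yu
          adj_neq[of u u] by auto
      with rs have r: "r = u" by auto
      have "s \<in> A \<or> s' \<in> A"
        using r rs(1) mem' by auto
      then have "\<exists>s \<in> A. dominating_set G {u, s}"
        using r rs(2,3) by blast
      then obtain s where s: "s \<in> A" "dominating_set G {u, s}" by blast
      \<comment> \<open>Neither \<open>u\<close> nor \<open>s\<close> has a neighbour in
        \<open>A\<close>, so the pair cannot dominate a second vertex of \<open>A\<close>.\<close>
      have "A \<subseteq> {s}"
        using dominated[OF s(2)] V uA indep s(1) uV adj_sym by blast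
      with s(1) A2 a show ?thesis by blast
    qed
  qed
qed

text \<open>Any cherry will do as a start; the cases distinguish how many of its leaves are adjacent
  to the centre.\<close>

lemma spanning_subgraph:
  "\<exists>E \<subseteq> parcs G. spanning_core (pverts G) E \<or> spanning_pentagon (pverts G) E \<or>
    spanning_matching (pverts G) E"
proof -
  obtain x where "x \<in> pverts G" using not_subset_3 by blast
  with cherry obtain y w w' where yw: "distinct [x, y, w, w']"
    "dominating_set G {y, w}" "dominating_set G {y, w'}"
    by (rule cherry_condE)
  then have y: "y \<in> pverts G" by (auto simp: dominating_set_pair)
  show ?thesis
  proof (cases "(y, w) \<in> parcs G"; cases "(y, w') \<in> parcs G")
    assume "(y, w) \<in> parcs G" "(y, w') \<in> parcs G"
    then show ?thesis using core_if_adjacent_centre[OF y _ yw(2,3)] yw(1) by auto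
  next
    assume "(y, w) \<notin> parcs G" "(y, w') \<notin> parcs G"
    then show ?thesis using pentagon_or_matching_if_far_centre[OF y _ yw(2,3)] yw(1) by auto
  next
    assume "(y, w) \<notin> parcs G" "(y, w') \<in> parcs G"
    then show ?thesis using core_or_matching_if_mixed_centre[OF y _ yw(2,3)] yw(1) by auto
  next
    assume "(y, w) \<in> parcs G" "(y, w') \<notin> parcs G"
    then show ?thesis using core_or_matching_if_mixed_centre[OF y _ yw(3,2)] yw(1) by auto
  qed
qed

end


section \<open>Critical graphs\<close>

text \<open>A vertex of \<open>A\<close> dominates \<open>V2\<close> and one of \<open>B\<close>
  dominates \<open>V1\<close>, so together they dominate. For \<open>x\<close> in \<open>B\<close>
  the centre is the other vertex of \<open>B\<close>; otherwise it is a vertex of \<open>A\<close>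
  different from \<open>x\<close>.\<close>

lemma spanning_core_cherry_cond:
  assumes "spanning_core (pverts G) (parcs G)"
  shows "cherry_cond G"
proof -
  obtain V1 V2 A B where V: "pverts G = V1 \<union> V2" "V1 \<inter> V2 = {}" "A \<subseteq> V1" "B \<subseteq> V2"
    and AB: "card A = 2" "card B = 2"
    and E: "parcs G = A \<times> V2 \<union> V1 \<times> B \<union> (V2 \<times> A \<union> B \<times> V1)"
    using assms unfolding spanning_core_def by blast
  obtain a a' b b' where A: "A = {a, a'}" "a \<noteq> a'" and B: "B = {b, b'}" "b \<noteq> b'"
    using AB unfolding card_2_iff by blast
  have pair: "dominating_set G {p, q}" "dominating_set G {q, p}" if "p \<in> A" "q \<in> B" for p q
    using that V E unfolding dominating_set_pair by blast+
  have dom: "dominating_set G {a, b}" "dominating_set G {a, b'}"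
    "dominating_set G {a', b}" "dominating_set G {a', b'}"
    "dominating_set G {b, a}" "dominating_set G {b, a'}"
    "dominating_set G {b', a}" "dominating_set G {b', a'}"
    by (simp_all add: pair A(1) B(1))
  have ab: "distinct [a, a', b, b']"
    using V A B by auto
  show ?thesis
    unfolding cherry_cond_def
  proof
    fix x
    consider "x = b" | "x = b'" | "x \<notin> B" "x \<noteq> a" | "x \<notin> B" "x \<noteq> a'"
      using A B by blast
    then show "\<exists>y w w'. distinct [x, y, w, w'] \<and> dominating_set G {y, w} \<and> dominating_set G {y, w'}"
    proof cases
      case 1
      with ab have "distinct [x, b', a, a']" by auto
      with dom show ?thesis by blast
    next
      case 2
      with ab have "distinct [x, b, a, a']" by auto
      with dom show ?thesis by blast
    next
      case 3
      with ab B have "distinct [x, a, b, b']" by auto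
      with dom show ?thesis by blast
    next
      case 4
      with ab B have "distinct [x, a', b, b']" by auto
      with dom show ?thesis by blast
    qed
  qed
qed

text \<open>Any two nonadjacent vertices of a 5-cycle dominate it. The cherry for \<open>x\<close>
  is centred at the successor of \<open>x\<close>; its leaves are the non-neighbours of that centre
  and so differ from \<open>x\<close>.\<close>

lemma spanning_pentagon_cherry_cond:
  assumes "spanning_pentagon (pverts G) (parcs G)"
  shows "cherry_cond G"
proof -
  obtain a b c d e where V: "distinct [a, b, c, d, e]" "pverts G = {a, b, c, d, e}"
    and E: "parcs G = {(a, b), (b, c), (c, d), (d, e), (e, a), (b, a), (c, b), (d, c), (e, d), (a, e)}"
    using assms unfolding spanning_pentagon_def by blast
  have dom: "dominating_set G {a, c}" "dominating_set G {a, d}"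
    "dominating_set G {b, d}" "dominating_set G {b, e}"
    "dominating_set G {c, e}" "dominating_set G {c, a}"
    "dominating_set G {d, a}" "dominating_set G {d, b}"
    "dominating_set G {e, b}" "dominating_set G {e, c}"
    unfolding dominating_set_pair E V(2) by auto
  show ?thesis
    unfolding cherry_cond_def
  proof
    fix x assume "x \<in> pverts G"
    then consider "x = a" | "x = b" | "x = c" | "x = d" | "x = e" using V by blast
    then show "\<exists>y w w'. distinct [x, y, w, w'] \<and> dominating_set G {y, w} \<and> dominating_set G {y, w'}"
    proof cases
      case 1
      then have "distinct [x, b, d, e]" using V by auto
      with dom show ?thesis by blast
    next
      case 2
      then have "distinct [x, c, e, a]" using V by auto
      with dom show ?thesis by blast
    next
      case 3
      then have "distinct [x, d, a, b]" using V by auto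
      with dom show ?thesis by blast
    next
      case 4
      then have "distinct [x, e, b, c]" using V by auto
      with dom show ?thesis by blast
    next
      case 5
      then have "distinct [x, a, c, d]" using V by auto
      with dom show ?thesis by blast
    qed
  qed
qed

text \<open>One vertex from each edge dominates; the cherry for \<open>x\<close> has the partner of
  \<open>x\<close> as centre and the ends of the other edge as leaves.\<close>

lemma spanning_matching_cherry_cond:
  assumes "spanning_matching (pverts G) (parcs G)"
  shows "cherry_cond G"
proof -
  obtain a b c d where V: "distinct [a, b, c, d]" "pverts G = {a, b, c, d}"
    and E: "parcs G = {(a, b), (c, d), (b, a), (d, c)}"
    using assms unfolding spanning_matching_def by blast
  have dom: "dominating_set G {a, c}" "dominating_set G {a, d}" "dominating_set G {b, c}"
    "dominating_set G {b, d}"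
    unfolding dominating_set_pair E V(2) by auto
  show ?thesis
    unfolding cherry_cond_def
  proof
    fix x assume "x \<in> pverts G"
    then consider "x = a" | "x = b" | "x = c" | "x = d" using V by blast
    then show "\<exists>y w w'. distinct [x, y, w, w'] \<and> dominating_set G {y, w} \<and> dominating_set G {y, w'}"
    proof cases
      case 1
      then have "distinct [x, b, c, d]" using V by auto
      with dom show ?thesis by blast
    next
      case 2
      then have "distinct [x, a, c, d]" using V by auto
      with dom show ?thesis by blast
    next
      case 3
      then have "distinct [x, d, a, b]" using V by auto
      with dom show ?thesis by (metis insert_commute)
    next
      case 4
      then have "distinct [x, c, a, b]" using V by auto
      with dom show ?thesis by (metis insert_commute)
    qed
  qed
qed

section \<open>Symmetry, arc counts and bipartiteness of the spanning graphs\<close>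

lemma sym_spanning_core: "spanning_core V E \<Longrightarrow> sym E"
  unfolding spanning_core_def sym_def by blast

lemma sym_spanning_pentagon: "spanning_pentagon V E \<Longrightarrow> sym E"
  unfolding spanning_pentagon_def sym_def by auto

lemma sym_spanning_matching: "spanning_matching V E \<Longrightarrow> sym E"
  unfolding spanning_matching_def sym_def by auto

text \<open>Every edge counts as two arcs. \<open>P\<close> keeps the one directed from
  \<open>V1\<close> to \<open>V2\<close>; splitting by whether the tail lies in \<open>A\<close>
  gives a size that depends only on the order of the graph.\<close>

lemma card_spanning_core:
  assumes core: "spanning_core V E" and fin: "finite V"
  shows "card E = 4 * card V - 8"
proof -
  obtain V1 V2 A B where V: "V = V1 \<union> V2" "V1 \<inter> V2 = {}" "A \<subseteq> V1" "B \<subseteq> V2"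
    and AB: "card A = 2" "card B = 2"
    and E: "E = A \<times> V2 \<union> V1 \<times> B \<union> (V2 \<times> A \<union> B \<times> V1)"
    using core unfolding spanning_core_def by blast
  have fins: "finite V1" "finite V2" "finite A" "finite B"
    using V fin by (auto intro: finite_subset)
  define P where "P = A \<times> V2 \<union> (V1 - A) \<times> B"
  have P: "P \<subseteq> V1 \<times> V2" "finite P"
    using V fins by (auto simp: P_def)
  have "E = P \<union> P\<inverse>"
    using V by (auto simp: E P_def)
  moreover have "P \<inter> P\<inverse> = {}"
    using P V by blast
  ultimately have "card E = card P + card P"
    using P by (simp add: card_Un_disjoint card_inverse)
  moreover have "card P = card A * card V2 + card (V1 - A) * card B"
    unfolding P_def using fins by (subst card_Un_disjoint) (auto simp: card_cartesian_product)
  moreover have "card (V1 - A) = card V1 - 2" "card V1 \<ge> 2"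
    using V AB fins card_mono[of V1 A] by (auto simp: card_Diff_subset)
  moreover have "card V = card V1 + card V2"
    using V fins by (simp add: card_Un_disjoint)
  ultimately show ?thesis using AB by simp
qed

lemma card_spanning_pentagon:
  assumes "spanning_pentagon V E"
  shows "card V = 5" "card E = 10"
  using assms unfolding spanning_pentagon_def by auto

lemma card_spanning_matching:
  assumes "spanning_matching V E"
  shows "card V = 4"
  using assms unfolding spanning_matching_def by auto

text \<open>A core is bipartite, so membership in \<open>V1\<close> would have to alternate around
  an odd cycle. Arc counts cannot decide this case: on five vertices a core has 12 arcs and a
  pentagon 10.\<close>

lemma spanning_pentagon_not_subset_core:
  assumes "spanning_pentagon V E" "E \<subseteq> E'" "spanning_core V E'"
  shows False
proof -
  obtain a b c d e where V: "V = {a, b, c, d, e}"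
    and E: "{(a, b), (b, c), (c, d), (d, e), (e, a)} \<subseteq> E"
    using assms(1) unfolding spanning_pentagon_def by auto
  obtain V1 V2 where V': "V = V1 \<union> V2" "V1 \<inter> V2 = {}"
    and E': "E' \<subseteq> V1 \<times> V2 \<union> V2 \<times> V1"
    using assms(3) unfolding spanning_core_def by blast
  have alt: "u \<in> V1 \<longleftrightarrow> v \<notin> V1" if "(u, v) \<in> E" for u v
    using that assms(2) E' V' by blast
  show False
    using alt[of a b] alt[of b c] alt[of c d] alt[of d e] alt[of e a] E by auto
qed

text \<open>Two opposite edges of the 4-cycle form the matching. This is what excludes the 4-cycle
  from the critical graphs.\<close>

lemma spanning_core_card_4:
  assumes "spanning_core V E" "card V = 4"
  shows "\<exists>E' \<subseteq> E. spanning_matching V E'"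
proof -
  obtain V1 V2 A B where V: "V = V1 \<union> V2" "V1 \<inter> V2 = {}" "A \<subseteq> V1" "B \<subseteq> V2"
    and AB: "card A = 2" "card B = 2"
    and E: "E = A \<times> V2 \<union> V1 \<times> B \<union> (V2 \<times> A \<union> B \<times> V1)"
    using assms(1) unfolding spanning_core_def by blast
  obtain a a' b b' where A: "A = {a, a'}" "a \<noteq> a'" and B: "B = {b, b'}" "b \<noteq> b'"
    using AB unfolding card_2_iff by blast
  have ab: "distinct [a, b, a', b']"
    using V A B by auto
  then have "card {a, b, a', b'} = card V" using assms(2) by simp
  moreover have "{a, b, a', b'} \<subseteq> V" "finite V"
    using V A B assms(2) by (auto intro: card_ge_0_finite)
  ultimately have V_eq: "V = {a, b, a', b'}"
    by (metis card_subset_eq)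
  let ?E = "{(a, b), (a', b'), (b, a), (b', a')}"
  have "spanning_matching V ?E"
    unfolding spanning_matching_def using ab V_eq by blast
  moreover have "?E \<subseteq> E" using V A B by (auto simp: E)
  ultimately show ?thesis by (intro exI[of _ ?E] conjI)
qed

text \<open>An edge outside \<open>E\<close> could be deleted without losing the cherry condition,
  so the value would stay at most 2. Symmetry of \<open>E\<close> ensures that both arcs of that
  edge avoid \<open>E\<close>.\<close>

lemma two_mb_critical_spanning_eq:
  assumes crit: "two_mb_critical G" and card: "card (pverts G) \<ge> 4"
    and sub: "E \<subseteq> parcs G" and sym: "sym E" and cherry: "cherry_cond (G\<lparr>parcs := E\<rparr>)"
  shows "parcs G = E"
proof (rule ccontr)
  assume "parcs G \<noteq> E"
  with sub obtain u v where uv: "(u, v) \<in> parcs G" "(u, v) \<notin> E" by auto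
  with sym have "(v, u) \<notin> E" by (auto dest: symD)
  with uv sub have "E \<subseteq> parcs (delete_edge G u v)" by (auto simp: delete_edge_def)
  then have "cherry_cond (delete_edge G u v)"
    by (intro cherry_cond_mono[OF cherry]) (auto simp: delete_edge_def)
  then have "\<gamma>\<^sub>M\<^sub>B' (delete_edge G u v) \<le> 2"
    using card by (subst mb_dom_number'_le_2_iff) (auto simp: delete_edge_def)
  with crit uv show False unfolding two_mb_critical_def by fastforce
qed

section \<open>Critical graphs and spanning subgraphs: the two directions\<close>

context pair_graph
begin

lemma pair_graph_delete_edge: "pair_graph (delete_edge G u v)"
proof unfold_locales
  show "symmetric (with_proj (delete_edge G u v))"
    using sym_parcs unfolding symmetric_def sym_def by (auto simp: delete_edge_def)
qed (auto simp: delete_edge_def dest: in_arcsD1 in_arcsD2 pair_no_loops)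

lemma spanning_matching_not_connected:
  assumes matching: "spanning_matching (pverts G) (parcs G)"
  shows "\<not> connected (with_proj G)"
proof
  assume "connected (with_proj G)"
  then have sc: "strongly_connected (with_proj G)"
    using symmetric_connected_imp_strongly_connected pair_sym_arcs by blast
  obtain a b c d where V: "distinct [a, b, c, d]" "pverts G = {a, b, c, d}"
    and E: "parcs G = {(a, b), (c, d), (b, a), (d, c)}"
    using matching unfolding spanning_matching_def by blast
  have "a \<rightarrow>\<^sup>*\<^bsub>with_proj G\<^esub> c"
    using sc V unfolding strongly_connected_def by auto
  then have "c \<in> {a, b}"
  proof (induction rule: reachable_induct)
    case (step x y)
    then show ?case using V(1) by (auto simp: E)
  qed simp
  with V(1) show False by auto
qed

lemma two_mb_critical_imp:
  assumes conn: "connected (with_proj G)" and tf: "triangle_free G" and crit: "two_mb_critical G"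
  shows "spanning_core (pverts G) (parcs G) \<and> card (pverts G) \<ge> 5 \<or>
    spanning_pentagon (pverts G) (parcs G)"
proof -
  have card: "card (pverts G) \<ge> 4"
    using crit mb_dom_number'_2_imp_card[OF pair_finite_verts] unfolding two_mb_critical_def by blast
  then have cherry: "cherry_cond G"
    using crit mb_dom_number'_le_2_iff[OF card] unfolding two_mb_critical_def by simp
  interpret triangle_free_cherry G
    using tf cherry card by unfold_locales
  \<comment> \<open>By criticality a spanning matching would be the whole graph, against
    connectedness.\<close>
  have no_matching: "\<not> spanning_matching (pverts G) E" if "E \<subseteq> parcs G" for E
  proof
    assume matching: "spanning_matching (pverts G) E"
    then have "parcs G = E"
      using two_mb_critical_spanning_eq[OF crit card that sym_spanning_matching]
        spanning_matching_cherry_cond[of "G\<lparr>parcs := E\<rparr>"] by simp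
    with matching spanning_matching_not_connected conn show False by simp
  qed
  obtain E where E: "E \<subseteq> parcs G"
    and cases: "spanning_core (pverts G) E \<or> spanning_pentagon (pverts G) E \<or>
      spanning_matching (pverts G) E"
    using spanning_subgraph by blast
  from cases no_matching[OF E] consider "spanning_core (pverts G) E" | "spanning_pentagon (pverts G) E"
    by blast
  then show ?thesis
  proof cases
    case 1
    then have "parcs G = E"
      using two_mb_critical_spanning_eq[OF crit card E sym_spanning_core]
        spanning_core_cherry_cond[of "G\<lparr>parcs := E\<rparr>"] by simp
    moreover have "card (pverts G) \<noteq> 4"
      using spanning_core_card_4[OF 1] no_matching E by blast
    ultimately show ?thesis using 1 card by simp
  next
    case 2
    then have "parcs G = E"
      using two_mb_critical_spanning_eq[OF crit card E sym_spanning_pentagon]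
        spanning_pentagon_cherry_cond[of "G\<lparr>parcs := E\<rparr>"] by simp
    with 2 show ?thesis by simp
  qed
qed

lemma imp_two_mb_critical:
  assumes tf: "triangle_free G"
    and G: "spanning_core (pverts G) (parcs G) \<and> card (pverts G) \<ge> 5 \<or>
      spanning_pentagon (pverts G) (parcs G)"
  shows "two_mb_critical G"
proof -
  have card: "card (pverts G) \<ge> 5"
    using G card_spanning_pentagon by fastforce
  then have card4: "card (pverts G) \<ge> 4" by simp
  have "cherry_cond G"
    using G spanning_core_cherry_cond spanning_pentagon_cherry_cond by blast
  then have "\<gamma>\<^sub>M\<^sub>B' G \<le> 2" using mb_dom_number'_le_2_iff[OF card4] by simp
  moreover have "\<not> \<gamma>\<^sub>M\<^sub>B' G \<le> 1"
    using triangle_free_mb_dom_number'_gt_1[OF tf sym_parcs] card by simp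
  ultimately have two: "\<gamma>\<^sub>M\<^sub>B' G = 2"
    by (cases "\<gamma>\<^sub>M\<^sub>B' G") (auto simp: numeral_eq_enat one_enat_def)
  have "\<gamma>\<^sub>M\<^sub>B' (delete_edge G u v) > 2" if uv: "(u, v) \<in> parcs G" for u v
  proof (rule ccontr)
    let ?H = "delete_edge G u v"
    have H: "pverts ?H = pverts G" "parcs ?H \<subset> parcs G"
      using uv by (auto simp: delete_edge_def)
    assume "\<not> \<gamma>\<^sub>M\<^sub>B' ?H > 2"
    then have "cherry_cond ?H"
      using mb_dom_number'_le_2_iff[of ?H] card4 H(1) by (simp add: not_less)
    moreover have "triangle_free ?H"
      using tf H(2) unfolding triangle_free_def by blast
    ultimately have "triangle_free_cherry ?H"
      using pair_graph_delete_edge[of u v] card4 H(1)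
      by (simp add: triangle_free_cherry_def triangle_free_cherry_axioms_def)
    then obtain E where E: "E \<subseteq> parcs ?H"
      and cases: "spanning_core (pverts G) E \<or> spanning_pentagon (pverts G) E \<or>
        spanning_matching (pverts G) E"
      using triangle_free_cherry.spanning_subgraph[of ?H] unfolding H(1) by blast
    have less: "card E < card (parcs G)"
      using E H(2) by (intro psubset_card_mono pair_finite_arcs) (rule subset_psubset_trans)
    have sub: "E \<subseteq> parcs G" using E H(2) by (meson order_trans psubset_imp_subset)
    note core_card = card_spanning_core[OF _ pair_finite_verts]
    \<comment> \<open>Equal arc counts exclude a core inside a core and a pentagon inside a
      pentagon. A core on five vertices has more arcs than the pentagon, a pentagon is an odd cycle
      and does not fit into a core, and a matching has only four vertices.\<close>
    from cases G card less show False
    proof (elim disjE conjE)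
      assume "spanning_core (pverts G) E" "spanning_core (pverts G) (parcs G)"
      with less show False by (simp add: core_card)
    next
      assume "spanning_core (pverts G) E" "spanning_pentagon (pverts G) (parcs G)"
      with less show False by (simp add: core_card card_spanning_pentagon)
    next
      assume "spanning_pentagon (pverts G) E" "spanning_core (pverts G) (parcs G)"
      with sub show False using spanning_pentagon_not_subset_core by blast
    next
      assume "spanning_pentagon (pverts G) E" "spanning_pentagon (pverts G) (parcs G)"
      with less show False by (simp add: card_spanning_pentagon(2))
    next
      assume "spanning_matching (pverts G) E"
      with card show False by (simp add: card_spanning_matching)
    next
      assume "spanning_matching (pverts G) E"
      with card show False by (simp add: card_spanning_matching)
    qed
  qed
  with two show ?thesis unfolding two_mb_critical_def by blast
qed

end


section \<open>Identification of the extremal graphs\<close>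

lemma digraph_iso_cycle_5_iff:
  assumes "pair_graph G"
  shows "digraph_iso (with_proj G) (with_proj (cycle_graph 5)) \<longleftrightarrow>
    spanning_pentagon (pverts G) (parcs G)"
proof -
  interpret pair_graph G by fact
  have verts5: "pverts (cycle_graph 5) = {0, 1, 2, 3, 4}"
    by (auto simp: cycle_graph_def)
  have "parcs (cycle_graph 5) = (\<Union>i<5. {(i, Suc i mod 5), (Suc i mod 5, i)})"
    by (auto simp: cycle_graph_def)
  then have parcs5: "parcs (cycle_graph 5) = {(0, 1), (1, 2), (2, 3), (3, 4), (4, 0),
      (1, 0), (2, 1), (3, 2), (4, 3), (0, 4)}"
    by (simp add: lessThan_nat_numeral lessThan_Suc numeral_2_eq_2[symmetric] insert_commute)
  show ?thesis
  proof
    assume "digraph_iso (with_proj G) (with_proj (cycle_graph 5))"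
    then obtain f where iso: "digraph_isomorphism f"
      and app: "with_proj (cycle_graph 5) = app_iso f (with_proj G)"
      unfolding digraph_iso_def by blast
    define h where "h = iso_verts f"
    have inj: "inj_on h (pverts G)"
      using iso by (simp add: digraph_isomorphism_def h_def)
    have verts: "h ` pverts G = pverts (cycle_graph 5)"
      using arg_cong[OF app, of verts] by (simp add: h_def)
    have arcs: "parcs (cycle_graph 5) = iso_arcs f ` parcs G"
      using arg_cong[OF app, of arcs] by simp
    \<comment> \<open>Both digraphs have the projections as tail and head, so \<open>f\<close> must
      act on arcs as \<open>map_prod h h\<close> and is determined by its vertex map.\<close>
    have "iso_tail f = fst" "iso_head f = snd"
      using arg_cong[OF app, of tail] arg_cong[OF app, of head] by simp_all
    then have "iso_arcs f e = map_prod h h e" if "e \<in> parcs G" for e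
      using iso that by (auto simp: digraph_isomorphism_def h_def prod_eq_iff)
    with arcs have parcs: "parcs (cycle_graph 5) = map_prod h h ` parcs G"
      by simp
    \<comment> \<open>The inverse of the labelling lists the vertices of the pentagon in cyclic
      order as \<open>g 0\<close> to \<open>g 4\<close>.\<close>
    define g where "g = the_inv_into (pverts G) h"
    have g: "g (h v) = v" if "v \<in> pverts G" for v
      using inj that by (simp add: g_def the_inv_into_f_f)
    have "map_prod g g ` parcs (cycle_graph 5) = (\<lambda>e. map_prod g g (map_prod h h e)) ` parcs G"
      unfolding parcs by (rule image_image)
    also have "\<dots> = (\<lambda>e. e) ` parcs G"
      by (rule image_cong) (auto intro!: g intro: in_arcsD1 in_arcsD2)
    finally have "parcs G = map_prod g g ` parcs (cycle_graph 5)" by simp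
    then have E: "parcs G = {(g 0, g 1), (g 1, g 2), (g 2, g 3), (g 3, g 4), (g 4, g 0),
        (g 1, g 0), (g 2, g 1), (g 3, g 2), (g 4, g 3), (g 0, g 4)}"
      by (simp add: parcs5)
    have "g ` pverts (cycle_graph 5) = (\<lambda>v. g (h v)) ` pverts G"
      unfolding verts[symmetric] by (rule image_image)
    also have "\<dots> = (\<lambda>v. v) ` pverts G"
      by (rule image_cong) (simp_all add: g)
    finally have "pverts G = g ` pverts (cycle_graph 5)" by simp
    then have V: "pverts G = {g 0, g 1, g 2, g 3, g 4}"
      by (simp add: verts5)
    have "inj_on g {0, 1, 2, 3, 4}"
      unfolding verts5[symmetric] verts[symmetric] by (rule inj_on_inverseI[of _ h]) (auto simp: g)
    then have "distinct (map g [0, 1, 2, 3, 4])"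
      unfolding distinct_map by simp
    then have "distinct [g 0, g 1, g 2, g 3, g 4]" by simp
    with V E show "spanning_pentagon (pverts G) (parcs G)"
      unfolding spanning_pentagon_def by blast
  next
    assume "spanning_pentagon (pverts G) (parcs G)"
    then obtain a b c d e where V: "distinct [a, b, c, d, e]" "pverts G = {a, b, c, d, e}"
      and E: "parcs G = {(a, b), (b, c), (c, d), (d, e), (e, a), (b, a), (c, b), (d, c), (e, d), (a, e)}"
      unfolding spanning_pentagon_def by blast
    \<comment> \<open>The default value 4 is the label of \<open>e\<close>.\<close>
    define h :: "'a \<Rightarrow> nat" where
      "h v = (if v = a then 0 else if v = b then 1 else if v = c then 2 else if v = d then 3 else 4)" for v
    have h: "h a = 0" "h b = 1" "h c = 2" "h d = 3" "h e = 4"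
      using V(1) by (auto simp: h_def)
    define f where "f = \<lparr>iso_verts = h, iso_arcs = map_prod h h, iso_head = snd, iso_tail = fst\<rparr>"
    have inj: "inj_on h (pverts G)"
      unfolding V(2) by (simp add: h inj_on_def)
    have "inj_on (map_prod h h) (parcs G)"
      by (rule inj_on_subset[OF map_prod_inj_on[OF inj inj]]) (auto dest: in_arcsD1 in_arcsD2)
    with inj have "digraph_isomorphism f"
      using wf_digraph by (simp add: digraph_isomorphism_def f_def)
    moreover have "with_proj (cycle_graph 5) = app_iso f (with_proj G)"
      by (simp add: with_proj_def app_iso_def f_def verts5 parcs5 V(2) E h)
    ultimately show "digraph_iso (with_proj G) (with_proj (cycle_graph 5))"
      unfolding digraph_iso_def by blast
  qed
qed

section \<open>Degrees and membership in \<open>family_B\<close>\<close>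

lemma degree_eq_card: "degree G v = card {w. (v, w) \<in> parcs G}"
proof -
  have "out_arcs (with_proj G) v = Pair v ` {w. (v, w) \<in> parcs G}"
    by (auto simp: out_arcs_def)
  then show ?thesis
    by (simp add: out_degree_def card_image inj_on_def)
qed

lemma spanning_core_family_B:
  assumes core: "spanning_core (pverts G) (parcs G)" and fin: "finite (pverts G)"
    and card: "card (pverts G) \<ge> 5"
  shows "family_B G"
proof -
  obtain V1 V2 A B where V: "pverts G = V1 \<union> V2" "V1 \<inter> V2 = {}" "A \<subseteq> V1" "B \<subseteq> V2"
    and AB: "card A = 2" "card B = 2"
    and E: "parcs G = A \<times> V2 \<union> V1 \<times> B \<union> (V2 \<times> A \<union> B \<times> V1)"
    using core unfolding spanning_core_def by blast
  have fins: "finite V1" "finite V2"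
    using V fin by auto
  have sum: "card V1 + card V2 \<ge> 5"
    using card V(1,2) fins by (simp add: card_Un_disjoint)
  have ge2: "card V1 \<ge> 2" "card V2 \<ge> 2"
    using V(3,4) AB fins card_mono by metis+
  \<comment> \<open>A part of size two coincides with \<open>A\<close> or \<open>B\<close>, which
    makes the graph complete bipartite; the other part then has at least three vertices.\<close>
  consider "card V1 = 2" | "card V2 = 2" | "card V1 \<ge> 3" "card V2 \<ge> 3"
    using ge2 by linarith
  then show ?thesis
  proof cases
    case 1
    then have "A = V1" using V(3) AB fins by (metis card_subset_eq)
    with V(4) have "parcs G = V1 \<times> V2 \<union> V2 \<times> V1" by (auto simp: E)
    with 1 V(1,2) fin have "K\<^bsub>2,card V2\<^esub> (with_proj G)"
      unfolding complete_bipartite_digraph_pair_def by blast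
    moreover have "card V2 \<ge> 3" using 1 sum by simp
    ultimately show ?thesis unfolding family_B_def by blast
  next
    case 2
    then have "B = V2" using V(4) AB fins by (metis card_subset_eq)
    with V(3) have "parcs G = V2 \<times> V1 \<union> V1 \<times> V2" by (auto simp: E)
    moreover have "pverts G = V2 \<union> V1" "V2 \<inter> V1 = {}" using V(1,2) by auto
    ultimately have "K\<^bsub>2,card V1\<^esub> (with_proj G)"
      using 2 fin unfolding complete_bipartite_digraph_pair_def by blast
    moreover have "card V1 \<ge> 3" using 2 sum by simp
    ultimately show ?thesis unfolding family_B_def by blast
  next
    case 3
    have nbrs1: "{w. (v, w) \<in> parcs G} = (if v \<in> A then V2 else B)" if "v \<in> V1" for v
      using that V(2-4) by (auto simp: E)
    have nbrs2: "{w. (v, w) \<in> parcs G} = (if v \<in> B then V1 else A)" if "v \<in> V2" for v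
      using that V(2-4) by (auto simp: E)
    have deg1: "degree G v = (if v \<in> A then card V2 else 2)" if "v \<in> V1" for v
      unfolding degree_eq_card nbrs1[OF that] using AB by simp
    have deg2: "degree G v = (if v \<in> B then card V1 else 2)" if "v \<in> V2" for v
      unfolding degree_eq_card nbrs2[OF that] using AB by simp
    \<comment> \<open>With at least three vertices in each part, degree 2 differs from full degree,
      so the degrees recover \<open>A\<close> and \<open>B\<close>.\<close>
    have "{v \<in> V1. degree G v = card V2} = A" "{v \<in> V2. degree G v = card V1} = B"
      using V(3,4) 3 by (auto simp: deg1 deg2 split: if_splits)
    with AB have "card {v \<in> V1. degree G v = card V2} = 2" "card {v \<in> V2. degree G v = card V1} = 2"
      by simp_all
    moreover have "bipartition G V1 V2"
      unfolding bipartition_def using V by (auto simp: E)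
    ultimately show ?thesis
      unfolding family_B_def
      by (intro disjI2, rule_tac exI[of _ V1], rule_tac exI[of _ V2], rule_tac exI[of _ "card V1"],
          rule_tac exI[of _ "card V2"]) (use 3 deg1 deg2 in auto)
  qed
qed

lemma family_B_spanning_core:
  assumes graph: "pair_graph G" and fam: "family_B G"
  shows "spanning_core (pverts G) (parcs G) \<and> card (pverts G) \<ge> 5"
proof -
  interpret pair_graph G by fact
  note fin = pair_finite_verts
  have core: ?thesis
    if V: "pverts G = V1 \<union> V2" "V1 \<inter> V2 = {}" "A \<subseteq> V1" "B \<subseteq> V2" "card A = 2" "card B = 2"
      "parcs G = A \<times> V2 \<union> V1 \<times> B \<union> (V2 \<times> A \<union> B \<times> V1)" "card V1 + card V2 \<ge> 5" for V1 V2 A B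
  proof -
    have "card (pverts G) = card V1 + card V2"
      using V(1,2) fin by (simp add: card_Un_disjoint)
    with V show ?thesis unfolding spanning_core_def by auto
  qed
  consider m where "m \<ge> 3" "K\<^bsub>2,m\<^esub> (with_proj G)" |
    V1 V2 where "bipartition G V1 V2" "card V1 \<ge> 3" "card V2 \<ge> 3"
      "card {v \<in> V1. degree G v = card V2} = 2" "card {v \<in> V2. degree G v = card V1} = 2"
      "\<forall>v \<in> V1. degree G v \<noteq> card V2 \<longrightarrow> degree G v = 2"
      "\<forall>v \<in> V2. degree G v \<noteq> card V1 \<longrightarrow> degree G v = 2"
    using fam unfolding family_B_def by blast
  then show ?thesis
  proof cases
    case 1
    then obtain U W where UW: "pverts G = U \<union> W" "U \<inter> W = {}" "card U = 2" "card W = m"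
      "parcs G = U \<times> W \<union> W \<times> U"
      unfolding complete_bipartite_digraph_pair_def by blast
    \<comment> \<open>Any two vertices of \<open>W\<close> can serve as \<open>B\<close>: with
      \<open>A = U\<close> all edges are already present.\<close>
    obtain B where "B \<subseteq> W" "card B = 2"
      using obtain_subset_with_card_n[of 2 W] 1 UW(4) by auto
    with UW 1 show ?thesis by (intro core[of U W U B]) auto
  next
    case 2
    define A B where "A = {v \<in> V1. degree G v = card V2}" and "B = {v \<in> V2. degree G v = card V1}"
    have V: "pverts G = V1 \<union> V2" "V1 \<inter> V2 = {}" and bip: "parcs G \<subseteq> V1 \<times> V2 \<union> V2 \<times> V1"
      using 2(1) unfolding bipartition_def by auto
    have fins: "finite V1" "finite V2" using V fin by auto
    have AB: "A \<subseteq> V1" "B \<subseteq> V2" "card A = 2" "card B = 2"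
      using 2 by (auto simp: A_def B_def)
    have sub1: "{w. (v, w) \<in> parcs G} \<subseteq> V2" if "v \<in> V1" for v
      using bip V(2) that by auto
    have sub2: "{w. (v, w) \<in> parcs G} \<subseteq> V1" if "v \<in> V2" for v
      using bip V(2) that by auto
    have full1: "(v, w) \<in> parcs G" "(w, v) \<in> parcs G" if "v \<in> A" "w \<in> V2" for v w
    proof -
      have "{w. (v, w) \<in> parcs G} = V2"
        using that(1) sub1 fins by (intro card_subset_eq) (auto simp: A_def degree_eq_card)
      then show "(v, w) \<in> parcs G" using that(2) by blast
      then show "(w, v) \<in> parcs G" using sym_parcs by (rule symD[rotated])
    qed
    have full2: "(v, w) \<in> parcs G" "(w, v) \<in> parcs G" if "v \<in> B" "w \<in> V1" for v w
    proof -
      have "{w. (v, w) \<in> parcs G} = V1"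
        using that(1) sub2 fins by (intro card_subset_eq) (auto simp: B_def degree_eq_card)
      then show "(v, w) \<in> parcs G" using that(2) by blast
      then show "(w, v) \<in> parcs G" using sym_parcs by (rule symD[rotated])
    qed
    \<comment> \<open>A vertex of \<open>V1\<close> outside \<open>A\<close> is adjacent to both
      vertices of \<open>B\<close>; having degree 2, it has no further neighbours.\<close>
    have other: "w \<in> B" if "v \<in> V1" "v \<notin> A" "(v, w) \<in> parcs G" for v w
    proof -
      have "degree G v = 2" using that(1,2) 2(6) by (auto simp: A_def)
      moreover have "B \<subseteq> {w. (v, w) \<in> parcs G}" using full2 that(1) by blast
      moreover have "finite {w. (v, w) \<in> parcs G}" by (rule finite_subset[OF sub1[OF that(1)] fins(2)])
      ultimately have "B = {w. (v, w) \<in> parcs G}"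
        using AB(4) by (intro card_subset_eq) (auto simp: degree_eq_card)
      with that(3) show ?thesis by blast
    qed
    have E: "parcs G = A \<times> V2 \<union> V1 \<times> B \<union> (V2 \<times> A \<union> B \<times> V1)"
    proof
      \<comment> \<open>Tails in \<open>V1\<close> suffice, since an arc from \<open>V2\<close> is
        handled through its reverse.\<close>
      have half: "v \<in> A \<or> w \<in> B" if "(v, w) \<in> parcs G" "v \<in> V1" for v w
        using other that by blast
      show "parcs G \<subseteq> A \<times> V2 \<union> V1 \<times> B \<union> (V2 \<times> A \<union> B \<times> V1)"
      proof
        fix e assume e: "e \<in> parcs G"
        obtain v w where vw: "e = (v, w)" by fastforce
        from e have vw_arc: "(v, w) \<in> parcs G" and wv_arc: "(w, v) \<in> parcs G"
          using sym_parcs by (auto simp: vw dest: symD)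
        then consider "v \<in> V1" "w \<in> V2" | "v \<in> V2" "w \<in> V1"
          using bip by blast
        then show "e \<in> A \<times> V2 \<union> V1 \<times> B \<union> (V2 \<times> A \<union> B \<times> V1)"
        proof cases
          case 1
          with half[OF vw_arc] show ?thesis unfolding vw by blast
        next
          case 2
          with half[OF wv_arc] show ?thesis unfolding vw by blast
        qed
      qed
      show "A \<times> V2 \<union> V1 \<times> B \<union> (V2 \<times> A \<union> B \<times> V1) \<subseteq> parcs G"
        by (intro Un_least subrelI) (simp_all add: full1 full2)
    qed
    show ?thesis
      using core[OF V AB E] 2(2,3) by simp
  qed
qed

theorem theorem2p6:
  fixes G :: "'a pair_pre_digraph"
  assumes "pair_graph G"
    and "connected (with_proj G)"
    and "triangle_free G"
  shows "two_mb_critical G \<longleftrightarrow>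
    family_B G \<or> digraph_iso (with_proj G) (with_proj (cycle_graph 5))"
proof -
  interpret pair_graph G by fact
  have "family_B G \<longleftrightarrow> spanning_core (pverts G) (parcs G) \<and> card (pverts G) \<ge> 5"
    using spanning_core_family_B[OF _ pair_finite_verts] family_B_spanning_core[OF assms(1)] by blast
  then show ?thesis
    unfolding digraph_iso_cycle_5_iff[OF assms(1)]
    using two_mb_critical_imp[OF assms(2,3)] imp_two_mb_critical[OF assms(3)] by blast
qed

end
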